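(* Let $x_1,\dots,x_n\in\mathbb{R}^{d+1}$ be points (each with $0$-th coordinate equal to $1$), let $\lambda\in\mathbb{R}^n_+$, let $p=\frac rs\ge1$ with $r,s$ positive integers, and let $B\subset\mathbb{R}^d$ be a polytope, symmetric with respect to the origin and with nonempty interior, with $\mathrm{Ext}(B)=\{b_1,\dots,b_G\}$. Then, for every sufficiently large constant $M>0$ (depending on the data), the disjunctive program $\mathrm{LRP}_{\Phi,B}$ defined in the context is equivalent to the following problem in the variables $\varepsilon\in\mathbb{R}^n$, $z,\theta\in\mathbb{R}^n_+$, $w\in\{0,1\}^{n\times n}$, and $\beta_h=(\beta_{0h},\beta_{-0h})\in\mathbb{R}\times\mathbb{R}^{d}$, $\xi_h\in\{0,1\}$ for $h=1,\dots,G$: $$\begin{aligned} \min\ & \sum_{j=1}^n\lambda_j\theta_j\\ \text{s.t. } & z_i\le\theta_j+M(1-w_{ij}), && i,j=1,\dots,n,\\ & z_i^s\ge\varepsilon_i^r, && i=1,\dots,n,\\ & \textstyle\sum_{i=1}^n w_{ij}=1\ (j=1,\dots,n),\quad \sum_{j=1}^n w_{ij}=1\ (i=1,\dots,n),\\ & \theta_j\ge\theta_{j-1}, && j=2,\dots,n,\\ & \varepsilon_i\ge\beta_h^tx_i,\quad \varepsilon_i\ge-\beta_h^tx_i, && i=1,\dots,n,\ h=1,\dots,G,\\ & \beta_{-0h}^t b_g\le1, && g,h=1,\dots,G,\\ & \beta_{-0h}^t b_h=\xi_h, && h=1,\dots,G,\\ & \textstyle\sum_{h=1}^G\xi_h=1.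 \end{aligned}$$
   Context: Vectors in $\mathbb{R}^{d+1}$ are indexed $0,1,\dots,d$; for $y\in\mathbb{R}^{d+1}$, $y_{-0}=(y_1,\dots,y_d)$. The disjunctive program $\mathrm{LRP}_{\Phi,B}$ is, in the variables $\beta\in\mathbb{R}^{d+1}$, $\varepsilon\in\mathbb{R}^n$, $z,\theta\in\mathbb{R}^n_+$, $w\in\{0,1\}^{n\times n}$: minimize $\sum_{j=1}^n\lambda_j\theta_j$ subject to $z_i\le\theta_j+M(1-w_{ij})$ for all $i,j$; $z_i^s\ge\varepsilon_i^r$ for all $i$; $\sum_i w_{ij}=1$ for all $j$; $\sum_j w_{ij}=1$ for all $i$; $\theta_j\ge\theta_{j-1}$ for $j=2,\dots,n$; $\varepsilon_i\ge\beta^tx_i$ and $\varepsilon_i\ge-\beta^tx_i$ for all $i$; $\beta_{-0}^tb_g\le1$ for all $g$; and $\beta_{-0}^tb_g=1$ for at least one $g\in\{1,\dots,G\}$. "Equivalent" means: the two problems have the same optimal value, and from an optimal solution of the second problem one obtains an optimal $\beta$ for $\mathrm{LRP}_{\Phi,B}$ by taking $\beta=\beta_h$ for the index $h$ with $\xi_h=1$, and conversely every optimal $\beta$ for $\mathrm{LRP}_{\Phi,B}$ arises in this way. *)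

theory Defs
  imports "HOL-Analysis.Analysis"
begin

text \<open>
  Vectors of \<open>\<real>\<^sup>d\<^sup>+\<^sup>1\<close>, indexed \<open>0, \<dots>, d\<close>, are pairs of type \<open>real \<times> (real ^ 'd)\<close>: \<open>fst\<close> is the
  0-th coordinate, \<open>snd \<beta>\<close> is \<open>\<beta>\<^bsub>-0\<^esub>\<close>, and the inner product is the one of the product type.
  Families indexed by \<open>1, \<dots>, n\<close> or \<open>1, \<dots>, G\<close> are functions on \<open>nat\<close>; their values outside the
  index range occur in no constraint and not in the objective.
\<close>

record omt_vars =
  epsv :: "nat \<Rightarrow> real"
  zv :: "nat \<Rightarrow> real"
  thetav :: "nat \<Rightarrow> real"
  wv :: "nat \<Rightarrow> nat \<Rightarrow> real"

record ('d::finite) lrp_vars = omt_vars +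
  betav :: "real \<times> (real ^ 'd)"

record ('d::finite) mip_vars = omt_vars +
  betas :: "nat \<Rightarrow> real \<times> (real ^ 'd)"
  xis :: "nat \<Rightarrow> real"

definition objective :: "nat \<Rightarrow> (nat \<Rightarrow> real) \<Rightarrow> 'a omt_vars_scheme \<Rightarrow> real" where
  "objective n lam v = (\<Sum>j=1..n. lam j * thetav v j)"

text \<open>The domains of, and the constraints on, \<open>\<epsilon>, z, \<theta>, w\<close> that the two problems share.\<close>

definition omt_constraints ::
  "nat \<Rightarrow> nat \<Rightarrow> nat \<Rightarrow> real \<Rightarrow> 'a omt_vars_scheme \<Rightarrow> bool" where
  "omt_constraints n r s M v \<longleftrightarrow>
     (\<forall>i\<in>{1..n}. zv v i \<ge> 0) \<and>
     (\<forall>j\<in>{1..n}. thetav v j \<ge> 0) \<and>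
     (\<forall>i\<in>{1..n}. \<forall>j\<in>{1..n}. wv v i j \<in> {0, 1}) \<and>
     (\<forall>i\<in>{1..n}. \<forall>j\<in>{1..n}. zv v i \<le> thetav v j + M * (1 - wv v i j)) \<and>
     (\<forall>i\<in>{1..n}. zv v i ^ s \<ge> epsv v i ^ r) \<and>
     (\<forall>j\<in>{1..n}. (\<Sum>i=1..n. wv v i j) = 1) \<and>
     (\<forall>i\<in>{1..n}. (\<Sum>j=1..n. wv v i j) = 1) \<and>
     (\<forall>j\<in>{2..n}. thetav v j \<ge> thetav v (j - 1))"

definition lrp_feasible ::
  "nat \<Rightarrow> (nat \<Rightarrow> real \<times> (real ^ 'd::finite)) \<Rightarrow> nat \<Rightarrow> nat \<Rightarrow> nat \<Rightarrow> (nat \<Rightarrow> real ^ 'd) \<Rightarrow>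
     real \<Rightarrow> 'd lrp_vars \<Rightarrow> bool" where
  "lrp_feasible n x r s G b M v \<longleftrightarrow>
     omt_constraints n r s M v \<and>
     (\<forall>i\<in>{1..n}. epsv v i \<ge> betav v \<bullet> x i \<and> epsv v i \<ge> - (betav v \<bullet> x i)) \<and>
     (\<forall>g\<in>{1..G}. snd (betav v) \<bullet> b g \<le> 1) \<and>
     (\<exists>g\<in>{1..G}. snd (betav v) \<bullet> b g = 1)"

definition mip_feasible ::
  "nat \<Rightarrow> (nat \<Rightarrow> real \<times> (real ^ 'd::finite)) \<Rightarrow> nat \<Rightarrow> nat \<Rightarrow> nat \<Rightarrow> (nat \<Rightarrow> real ^ 'd) \<Rightarrow>
     real \<Rightarrow> 'd mip_vars \<Rightarrow> bool" where
  "mip_feasible n x r s G b M v \<longleftrightarrow>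
     omt_constraints n r s M v \<and>
     (\<forall>h\<in>{1..G}. xis v h \<in> {0, 1}) \<and>
     (\<forall>i\<in>{1..n}. \<forall>h\<in>{1..G}.
        epsv v i \<ge> betas v h \<bullet> x i \<and> epsv v i \<ge> - (betas v h \<bullet> x i)) \<and>
     (\<forall>g\<in>{1..G}. \<forall>h\<in>{1..G}. snd (betas v h) \<bullet> b g \<le> 1) \<and>
     (\<forall>h\<in>{1..G}. snd (betas v h) \<bullet> b h = xis v h) \<and>
     (\<Sum>h=1..G. xis v h) = 1"

text \<open>The infimum is taken in \<open>ereal\<close>, so that an infeasible problem has optimal value \<open>\<infinity>\<close>.\<close>

definition optimal_value :: "('a \<Rightarrow> real) \<Rightarrow> ('a \<Rightarrow> bool) \<Rightarrow> ereal" where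
  "optimal_value f P = (INF v\<in>Collect P. ereal (f v))"

definition lrp_optimal_beta ::
  "nat \<Rightarrow> (nat \<Rightarrow> real \<times> (real ^ 'd::finite)) \<Rightarrow> (nat \<Rightarrow> real) \<Rightarrow> nat \<Rightarrow> nat \<Rightarrow> nat \<Rightarrow>
     (nat \<Rightarrow> real ^ 'd) \<Rightarrow> real \<Rightarrow> real \<times> (real ^ 'd) \<Rightarrow> bool" where
  "lrp_optimal_beta n x lam r s G b M \<beta> \<longleftrightarrow>
     (\<exists>u. is_arg_min (objective n lam) (lrp_feasible n x r s G b M) u \<and> betav u = \<beta>)"

definition lrp_mip_equivalent ::
  "nat \<Rightarrow> (nat \<Rightarrow> real \<times> (real ^ 'd::finite)) \<Rightarrow> (nat \<Rightarrow> real) \<Rightarrow> nat \<Rightarrow> nat \<Rightarrow> nat \<Rightarrow>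
     (nat \<Rightarrow> real ^ 'd) \<Rightarrow> real \<Rightarrow> bool" where
  "lrp_mip_equivalent n x lam r s G b M \<longleftrightarrow>
     optimal_value (objective n lam) (lrp_feasible n x r s G b M) =
       optimal_value (objective n lam) (mip_feasible n x r s G b M) \<and>
     (\<forall>v. is_arg_min (objective n lam) (mip_feasible n x r s G b M) v \<longrightarrow>
        (\<exists>!h. h \<in> {1..G} \<and> xis v h = 1) \<and>
        (\<forall>h\<in>{1..G}. xis v h = 1 \<longrightarrow> lrp_optimal_beta n x lam r s G b M (betas v h))) \<and>
     (\<forall>\<beta>. lrp_optimal_beta n x lam r s G b M \<beta> \<longrightarrow>
        (\<exists>v. is_arg_min (objective n lam) (mip_feasible n x r s G b M) v \<and>
           (\<exists>h\<in>{1..G}. xis v h = 1 \<and> betas v h = \<beta>)))"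

end

theory Submission
  imports Defs
begin

text \<open>
  The two problems share all variables except \<open>\<beta>\<close>. A feasible point of the second one has exactly
  one index \<open>h\<close> with \<open>\<xi>\<^sub>h = 1\<close>, and \<open>\<beta>\<^sub>h\<close> is then feasible for the first. Conversely, if
  \<open>\<beta>\<^bsub>-0\<^esub>\<^sup>tb\<^sub>g = 1\<close>, put \<open>\<beta>\<^sub>g = \<beta>\<close> and \<open>\<beta>\<^sub>h = 0\<close> for \<open>h \<noteq> g\<close>: the zero vector satisfies all constraints
  with \<open>\<xi>\<^sub>h = 0\<close>, because \<open>\<epsilon>\<^sub>i \<ge> \<bar>\<beta>\<^sup>tx\<^sub>i\<bar> \<ge> 0\<close>. Both passages keep \<open>\<theta>\<close>, hence the objective value.
\<close>

definition lrp_of_mip :: "nat \<Rightarrow> 'd::finite mip_vars \<Rightarrow> 'd lrp_vars" where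
  "lrp_of_mip h v =
     \<lparr>epsv = epsv v, zv = zv v, thetav = thetav v, wv = wv v, betav = betas v h\<rparr>"

text \<open>Meant for an index \<open>g\<close> at which \<open>u\<close> attains the equality of
  the disjunction.\<close>

definition mip_of_lrp :: "nat \<Rightarrow> 'd::finite lrp_vars \<Rightarrow> 'd mip_vars" where
  "mip_of_lrp g u =
     \<lparr>epsv = epsv u, zv = zv u, thetav = thetav u, wv = wv u,
      betas = (\<lambda>h. if h = g then betav u else 0), xis = (\<lambda>h. if h = g then 1 else 0)\<rparr>"

lemma objective_lrp_of_mip [simp]: "objective n lam (lrp_of_mip h v) = objective n lam v"
  by (simp add: objective_def lrp_of_mip_def)

lemma objective_mip_of_lrp [simp]: "objective n lam (mip_of_lrp g u) = objective n lam u"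
  by (simp add: objective_def mip_of_lrp_def)

text \<open>A sum of binary values counts the indices with value 1, so a sum of 1 makes their set a
  singleton.\<close>

lemma ex1_eq_1_if_sum_eq_1:
  fixes \<xi> :: "'a \<Rightarrow> real"
  assumes "finite A" and bin: "\<And>h. h \<in> A \<Longrightarrow> \<xi> h \<in> {0, 1}" and sum: "(\<Sum>h\<in>A. \<xi> h) = 1"
  shows "\<exists>!h. h \<in> A \<and> \<xi> h = 1"
proof -
  have "(\<Sum>h\<in>A. \<xi> h) = (\<Sum>h\<in>A. if \<xi> h = 1 then 1 else 0)"
    using bin by (intro sum.cong) auto
  also have "\<dots> = real (card {h \<in> A. \<xi> h = 1})"
    using \<open>finite A\<close> by (simp add: sum.If_cases Int_def)
  finally have "card {h \<in> A. \<xi> h = 1} = 1"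
    using sum by simp
  then obtain a where "{h \<in> A. \<xi> h = 1} = {a}"
    by (auto simp: card_1_singleton_iff)
  then show ?thesis
    by (intro ex1I[of _ a]) auto
qed

lemma mip_feasible_ex1:
  assumes "mip_feasible n x r s G b M v"
  shows "\<exists>!h. h \<in> {1..G} \<and> xis v h = 1"
proof (rule ex1_eq_1_if_sum_eq_1)
  show "xis v h \<in> {0, 1}" if "h \<in> {1..G}" for h
    using assms that unfolding mip_feasible_def by blast
  show "(\<Sum>h=1..G. xis v h) = 1"
    using assms unfolding mip_feasible_def by blast
qed simp

lemma lrp_feasible_lrp_of_mip:
  assumes "mip_feasible n x r s G b M v" and "h \<in> {1..G}" and "xis v h = 1"
  shows "lrp_feasible n x r s G b M (lrp_of_mip h v)"
proof -
  have "omt_constraints n r s M (lrp_of_mip h v)"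
    using assms(1) by (simp add: mip_feasible_def lrp_of_mip_def omt_constraints_def)
  moreover have "\<forall>i\<in>{1..n}. epsv v i \<ge> betas v h \<bullet> x i \<and> epsv v i \<ge> - (betas v h \<bullet> x i)"
    and "\<forall>g\<in>{1..G}. snd (betas v h) \<bullet> b g \<le> 1" and "snd (betas v h) \<bullet> b h = 1"
    using assms by (simp_all add: mip_feasible_def)
  ultimately show ?thesis
    using assms(2) by (auto simp: lrp_feasible_def lrp_of_mip_def)
qed

lemma mip_feasible_mip_of_lrp:
  assumes u: "lrp_feasible n x r s G b M u" and g: "g \<in> {1..G}" "snd (betav u) \<bullet> b g = 1"
  shows "mip_feasible n x r s G b M (mip_of_lrp g u)"
proof -
  have "epsv u i \<ge> 0" if "i \<in> {1..n}" for i
  proof -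
    have "epsv u i \<ge> betav u \<bullet> x i" "epsv u i \<ge> - (betav u \<bullet> x i)"
      using u that by (simp_all add: lrp_feasible_def)
    then show ?thesis
      by linarith
  qed
  moreover have "omt_constraints n r s M (mip_of_lrp g u)"
    using u by (simp add: lrp_feasible_def mip_of_lrp_def omt_constraints_def)
  ultimately show ?thesis
    using u g by (auto simp: mip_feasible_def lrp_feasible_def mip_of_lrp_def)
qed

text \<open>A point of \<open>Q\<close> better than \<open>u\<close> would be matched by a point of
  \<open>P\<close> better than \<open>v\<close>. Only this direction of matching enters.\<close>

lemma is_arg_min_transfer:
  fixes f :: "'a \<Rightarrow> 'c::linorder" and f' :: "'b \<Rightarrow> 'c"
  assumes "is_arg_min f P v" and "Q u" and "f' u = f v"
    and "\<And>u'. Q u' \<Longrightarrow> \<exists>v'. P v' \<and> f v' = f' u'"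
  shows "is_arg_min f' Q u"
  using assms unfolding is_arg_min_def by metis

text \<open>The infimum over \<open>Q\<close> ranges over at least the values attained on
  \<open>P\<close>. It need not be attained, and an empty \<open>P\<close> gives \<infinity> on the
  right.\<close>

lemma optimal_value_mono:
  assumes "\<And>v. P v \<Longrightarrow> \<exists>u. Q u \<and> f' u = f v"
  shows "optimal_value f' Q \<le> optimal_value f P"
  unfolding optimal_value_def
proof (rule INF_mono)
  fix v assume "v \<in> Collect P"
  then obtain u where "Q u" "f' u = f v"
    using assms by blast
  then show "\<exists>u\<in>Collect Q. ereal (f' u) \<le> ereal (f v)"
    by (intro bexI[of _ u]) auto
qed

text \<open>\<open>M\<close> enters only through \<open>omt_constraints\<close>, whose variables
  both passages copy unchanged.\<close>

lemma lrp_mip_equivalent_any_M: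
  fixes x :: "nat \<Rightarrow> real \<times> (real ^ 'd::finite)"
  shows "lrp_mip_equivalent n x lam r s G b M"
proof -
  let ?f = "objective n lam :: 'd lrp_vars \<Rightarrow> real"
  let ?f' = "objective n lam :: 'd mip_vars \<Rightarrow> real"
  let ?P = "lrp_feasible n x r s G b M"
  let ?Q = "mip_feasible n x r s G b M"
  have to_lrp: "\<exists>u. ?P u \<and> ?f u = ?f' v" if "?Q v" for v
    using lrp_feasible_lrp_of_mip[OF that] mip_feasible_ex1[OF that] objective_lrp_of_mip
    by blast
  have to_mip: "\<exists>v. ?Q v \<and> ?f' v = ?f u" if "?P u" for u
    using mip_feasible_mip_of_lrp[OF that] that objective_mip_of_lrp
    unfolding lrp_feasible_def by blast
  have "optimal_value ?f ?P = optimal_value ?f' ?Q"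
    \<comment> \<open>\<open>to_lrp\<close> gives \<le>, \<open>to_mip\<close> gives \<ge>.\<close>
    by (intro antisym optimal_value_mono to_lrp to_mip)
  moreover have "\<exists>!h. h \<in> {1..G} \<and> xis v h = 1" if "is_arg_min ?f' ?Q v" for v
    using that by (intro mip_feasible_ex1) (auto simp: is_arg_min_def)
  moreover have "lrp_optimal_beta n x lam r s G b M (betas v h)"
    if v: "is_arg_min ?f' ?Q v" and h: "h \<in> {1..G}" "xis v h = 1" for v h
  proof -
    have "?P (lrp_of_mip h v)"
      using v h by (intro lrp_feasible_lrp_of_mip) (auto simp: is_arg_min_def)
    \<comment> \<open>By \<open>to_mip\<close>, any better point of \<open>?P\<close> would yield a
      point of \<open>?Q\<close> better than \<open>v\<close>.\<close>
    then have "is_arg_min ?f ?P (lrp_of_mip h v)"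
      by (rule is_arg_min_transfer[OF v]) (simp_all add: to_mip)
    moreover have "betav (lrp_of_mip h v) = betas v h"
      by (simp add: lrp_of_mip_def)
    ultimately show ?thesis
      unfolding lrp_optimal_beta_def by blast
  qed
  moreover have "\<exists>v. is_arg_min ?f' ?Q v \<and> (\<exists>h\<in>{1..G}. xis v h = 1 \<and> betas v h = \<beta>)"
    if opt: "lrp_optimal_beta n x lam r s G b M \<beta>" for \<beta>
  proof -
    obtain u where u: "is_arg_min ?f ?P u" "betav u = \<beta>"
      using opt unfolding lrp_optimal_beta_def by blast
    \<comment> \<open>The disjunction supplies the index that will carry the value 1 of
      \<open>xis\<close>.\<close>
    then obtain g where g: "g \<in> {1..G}" "snd (betav u) \<bullet> b g = 1"
      by (auto simp: is_arg_min_def lrp_feasible_def)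
    have "?Q (mip_of_lrp g u)"
      using u g by (intro mip_feasible_mip_of_lrp) (auto simp: is_arg_min_def)
    then have "is_arg_min ?f' ?Q (mip_of_lrp g u)"
      by (rule is_arg_min_transfer[OF u(1)]) (simp_all add: to_lrp)
    moreover have "xis (mip_of_lrp g u) g = 1" "betas (mip_of_lrp g u) g = \<beta>"
      using u by (simp_all add: mip_of_lrp_def)
    ultimately show ?thesis
      using g(1) by blast
  qed
  ultimately show ?thesis
    unfolding lrp_mip_equivalent_def by blast
qed

theorem corollary19:
  fixes n r s G :: nat
    and x :: "nat \<Rightarrow> real \<times> (real ^ 'd::finite)"
    and lam :: "nat \<Rightarrow> real"
    and p :: real
    and B :: "(real ^ 'd) set"
    and b :: "nat \<Rightarrow> real ^ 'd"
  assumes "\<forall>i\<in>{1..n}. fst (x i) = 1"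
    and "\<forall>j\<in>{1..n}. lam j \<ge> 0"
    and "r > 0" and "s > 0" and "p = real r / real s" and "p \<ge> 1"
    and "polytope B" and "uminus ` B = B" and "interior B \<noteq> {}"
    and "{v. v extreme_point_of B} = b ` {1..G}"
  shows "\<exists>M0>0. \<forall>M\<ge>M0. lrp_mip_equivalent n x lam r s G b M"
  \<comment> \<open>The threshold 1 is an arbitrary positive number.\<close>
  using lrp_mip_equivalent_any_M by (intro exI[of _ 1]) auto

end
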